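(* Let $f:(0,1)\to\mathbb{S}^2\subset\mathbb{R}^3$ be non-constant and assume $f\in H^1(0,1;\mathbb{R}^3)$. Suppose that $f$ admits a cosine series representation $$f(x)=\sum_{k=0}^\infty a_k\cos(2\pi kx)\quad\text{in }L^2(0,1;\mathbb{R}^3),\qquad a_k\in\mathbb{R}^3.$$ Then $$\dim\bigl(\mathrm{Span}\{a_0,a_1,a_2,\dots\}\bigr)\ge2.$$ Moreover, $f$ cannot have only finitely many nonzero cosine modes: if $a_k=0$ for all $k>n$ for some $n\in\mathbb{N}$, then $f$ is constant. Consequently, if $f$ is non-constant, then $a_k\ne0$ for infinitely many $k\ge1$.
   Context: $\mathbb{S}^2$ is the unit sphere in $\mathbb{R}^3$. *)

theory Defs
  imports "HOL-Analysis.Analysis"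
begin

text \<open>
  Elements of \<open>L\<^sup>2\<close> and \<open>H\<^sup>1\<close> are represented by functions on the whole real line, of which only
  the restriction to \<open>S\<close> matters, and there only up to null sets.
\<close>

definition L2 :: "real set \<Rightarrow> (real \<Rightarrow> 'a::euclidean_space) set" where
  "L2 S = {f. f \<in> borel_measurable (lebesgue_on S) \<and>
              integrable (lebesgue_on S) (\<lambda>x. (norm (f x))\<^sup>2)}"

definition L2_norm :: "real set \<Rightarrow> (real \<Rightarrow> 'a::euclidean_space) \<Rightarrow> real" where
  "L2_norm S f = sqrt (\<integral>x. (norm (f x))\<^sup>2 \<partial>lebesgue_on S)"

text \<open>
  Membership in \<open>L2\<close> is part of the definition because the Bochner integral in \<open>L2_norm\<close> is \<open>0\<close>
  for non-integrable arguments.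
\<close>

definition tendsto_L2 ::
  "real set \<Rightarrow> (nat \<Rightarrow> real \<Rightarrow> 'a::euclidean_space) \<Rightarrow> (real \<Rightarrow> 'a) \<Rightarrow> bool" where
  "tendsto_L2 S F f \<longleftrightarrow> (\<forall>n. F n \<in> L2 S) \<and> f \<in> L2 S \<and>
     (\<lambda>n. L2_norm S (\<lambda>x. F n x - f x)) \<longlonglongrightarrow> 0"

definition test_function :: "real set \<Rightarrow> (real \<Rightarrow> real) \<Rightarrow> bool" where
  "test_function S \<phi> \<longleftrightarrow>
     (\<forall>n x. (deriv ^^ n) \<phi> field_differentiable at x) \<and>
     (\<exists>K. compact K \<and> K \<subseteq> S \<and> (\<forall>x. x \<notin> K \<longrightarrow> \<phi> x = 0))"

definition weak_derivative ::
  "real set \<Rightarrow> (real \<Rightarrow> 'a::euclidean_space) \<Rightarrow> (real \<Rightarrow> 'a) \<Rightarrow> bool" where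
  "weak_derivative S f g \<longleftrightarrow>
     (\<forall>\<phi>. test_function S \<phi> \<longrightarrow>
        (\<integral>x. deriv \<phi> x *\<^sub>R f x \<partial>lebesgue_on S) = - (\<integral>x. \<phi> x *\<^sub>R g x \<partial>lebesgue_on S))"

definition H1 :: "real set \<Rightarrow> (real \<Rightarrow> 'a::euclidean_space) set" where
  "H1 S = {f \<in> L2 S. \<exists>g \<in> L2 S. weak_derivative S f g}"

definition ae_constant_on :: "real set \<Rightarrow> (real \<Rightarrow> 'a::euclidean_space) \<Rightarrow> bool" where
  "ae_constant_on S f \<longleftrightarrow> (\<exists>c. AE x in lebesgue_on S. f x = c)"

definition has_cosine_series ::
  "(real \<Rightarrow> 'a::euclidean_space) \<Rightarrow> (nat \<Rightarrow> 'a) \<Rightarrow> bool" where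
  "has_cosine_series f a \<longleftrightarrow>
     tendsto_L2 {0<..<1} (\<lambda>n x. \<Sum>k\<le>n. cos (2 * pi * real k * x) *\<^sub>R a k) f"

end

theory Submission
  imports Defs "HOL-Computational_Algebra.Polynomial"
begin

text \<open>
  If all \<open>a k\<close> lie on a line, then so does \<open>f\<close> almost everywhere, and \<open>f\<close> takes at most two values.
  For an \<open>H\<^sup>1\<close> function with weak derivative \<open>g\<close> one has
  \<open>norm (f x - f y) \<le> integral {x..y} (\<lambda>t. norm (g t))\<close> at almost all \<open>x \<le> y\<close>, so \<open>f\<close> has a
  continuous representative, and a finite range makes it constant.

  If only finitely many modes occur, then \<open>f\<close> is a vector of polynomials in \<open>cos (2 * pi * x)\<close>. The squares
  of these polynomials sum to \<open>1\<close> on \<open>{-1<..<1}\<close>, hence on the whole line, and a bounded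
  real polynomial is constant.
\<close>

subsection \<open>Smooth bump functions\<close>

text \<open>\<open>test_function\<close> asks for derivatives of every order at once. Bounding the
  order gives a notion that can be proved by induction on \<open>n\<close>, peeling off the
  innermost \<open>deriv\<close>.\<close>

definition differentiable_upto :: "nat \<Rightarrow> (real \<Rightarrow> real) \<Rightarrow> bool" where
  "differentiable_upto n f \<longleftrightarrow> (\<forall>m\<le>n. \<forall>x. (deriv ^^ m) f field_differentiable at x)"

lemma differentiable_upto_0:
  "differentiable_upto 0 f \<longleftrightarrow> (\<forall>x. f field_differentiable at x)"
  by (simp add: differentiable_upto_def)

lemma differentiable_upto_Suc:
  "differentiable_upto (Suc n) f \<longleftrightarrow>
     (\<forall>x. f field_differentiable at x) \<and> differentiable_upto n (deriv f)"
proof -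
  have "(\<forall>m\<le>Suc n. P m) \<longleftrightarrow> P 0 \<and> (\<forall>m\<le>n. P (Suc m))" for P :: "nat \<Rightarrow> bool"
    unfolding less_Suc_eq_le[symmetric] by (rule All_less_Suc2)
  then show ?thesis
    by (simp add: differentiable_upto_def funpow_Suc_right del: funpow.simps)
qed

lemma differentiable_upto_differentiable:
  "differentiable_upto n f \<Longrightarrow> f field_differentiable at x"
  by (cases n) (auto simp: differentiable_upto_0 differentiable_upto_Suc)

lemma differentiable_upto_SucD: "differentiable_upto (Suc n) f \<Longrightarrow> differentiable_upto n f"
  by (simp add: differentiable_upto_def)

lemma differentiable_upto_add:
  assumes "differentiable_upto n f" "differentiable_upto n g"
  shows "differentiable_upto n (\<lambda>x. f x + g x)"
  using assms
proof (induction n arbitrary: f g)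
  case 0
  then show ?case by (auto simp: differentiable_upto_0 intro: field_differentiable_add)
next
  case (Suc n)
  then have "deriv (\<lambda>x. f x + g x) = (\<lambda>x. deriv f x + deriv g x)"
    by (auto simp: differentiable_upto_Suc)
  with Suc show ?case
    by (auto simp: differentiable_upto_Suc intro: field_differentiable_add)
qed

lemma differentiable_upto_mult:
  assumes "differentiable_upto n f" "differentiable_upto n g"
  shows "differentiable_upto n (\<lambda>x. f x * g x)"
  using assms
proof (induction n arbitrary: f g)
  case 0
  then show ?case by (auto simp: differentiable_upto_0 intro: field_differentiable_mult)
next
  case (Suc n)
  then have "deriv (\<lambda>x. f x * g x) = (\<lambda>x. f x * deriv g x + deriv f x * g x)"
    by (auto simp: differentiable_upto_Suc)
  \<comment> \<open>The product rule leaves \<open>f\<close> and \<open>g\<close> undifferentiated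
    in one term each, so the induction hypothesis also needs them at the lower order
    \<open>n\<close>.\<close>
  with Suc show ?case
    by (simp add: differentiable_upto_Suc field_differentiable_mult differentiable_upto_add
        Suc.IH Suc.prems[THEN differentiable_upto_SucD])
qed

lemma differentiable_upto_const: "differentiable_upto n (\<lambda>x. c)"
proof (induction n arbitrary: c)
  case 0
  then show ?case by (simp add: differentiable_upto_0)
next
  case (Suc n)
  have "deriv (\<lambda>x. c) = (\<lambda>x. 0)" by auto
  with Suc show ?case by (simp add: differentiable_upto_Suc)
qed

lemma differentiable_upto_affine:
  assumes "differentiable_upto n f"
  shows "differentiable_upto n (\<lambda>x. f (a * x + b))"
proof -
  have D: "((\<lambda>x. f (a * x + b)) has_field_derivative a * deriv f (a * x + b)) (at x)"
    if "f field_differentiable at (a * x + b)" for f x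
  proof -
    have "((\<lambda>x. a * x + b) has_field_derivative a) (at x)"
      by (auto intro!: derivative_eq_intros)
    from DERIV_chain2[OF field_differentiable_derivI[OF that] this] show ?thesis
      by (simp add: mult.commute)
  qed
  show ?thesis
    using assms
  proof (induction n arbitrary: f)
    case (0 f)
    then show ?case
      unfolding differentiable_upto_0 using D field_differentiable_def by blast
  next
    case (Suc n f)
    then have "deriv (\<lambda>x. f (a * x + b)) = (\<lambda>x. a * deriv f (a * x + b))"
      by (intro ext DERIV_imp_deriv D) (simp add: differentiable_upto_Suc)
    moreover have "(\<lambda>x. f (a * x + b)) field_differentiable at x" for x
      using Suc.prems D field_differentiable_def differentiable_upto_differentiable by blast
    ultimately show ?case
      using Suc by (auto simp: differentiable_upto_Suc intro!: differentiable_upto_mult differentiable_upto_const)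
  qed
qed

text \<open>The polynomial factor makes this family closed under differentiation.\<close>
definition flat :: "real poly \<Rightarrow> real \<Rightarrow> real" where
  "flat p x = (if x > 0 then poly p (1 / x) * exp (- (1 / x)) else 0)"

lemma poly_div_exp_tendsto_0: "((\<lambda>x::real. poly p x / exp x) \<longlongrightarrow> 0) at_top"
proof -
  have "((\<lambda>x::real. \<Sum>i\<le>degree p. coeff p i * (x ^ i / exp x)) \<longlongrightarrow> (\<Sum>i\<le>degree p. coeff p i * 0)) at_top"
    by (intro tendsto_sum tendsto_mult tendsto_const tendsto_power_div_exp_0)
  then show ?thesis
    by (simp add: poly_altdef sum_divide_distrib)
qed

text \<open>With \<open>u = 1 / x\<close>, the derivative of \<open>poly p u * exp (- u)\<close> in
  \<open>x\<close> is \<open>u^2 * (p - p')(u) * exp (- u)\<close>; the factor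
  \<open>[:0, 0, 1:]\<close> is this \<open>u^2\<close>. At \<open>0\<close> exponential decay beats
  every polynomial in \<open>u\<close>.\<close>

lemma flat_has_field_derivative:
  "(flat p has_field_derivative flat ([:0, 0, 1:] * (p - pderiv p)) x) (at x)"
proof -
  consider "x > 0" | "x < 0" | "x = 0" by linarith
  then show ?thesis
  proof cases
    case 1
    have "((\<lambda>x. poly p (1 / x) * exp (- (1 / x))) has_field_derivative
            flat ([:0, 0, 1:] * (p - pderiv p)) x) (at x)"
      using 1 unfolding flat_def
      by (auto intro!: derivative_eq_intros DERIV_chain2[OF poly_DERIV]
          simp: field_simps power2_eq_square)
    then show ?thesis
      by (rule has_field_derivative_transform_within_open[of _ _ _ "{0<..}"])
         (use 1 in \<open>auto simp: flat_def\<close>)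
  next
    case 2
    have "((\<lambda>x. 0) has_field_derivative flat ([:0, 0, 1:] * (p - pderiv p)) x) (at x)"
      using 2 by (auto simp: flat_def)
    then show ?thesis
      by (rule has_field_derivative_transform_within_open[of _ _ _ "{..<0}"])
         (use 2 in \<open>auto simp: flat_def\<close>)
  next
    case 3
    \<comment> \<open>The difference quotient at \<open>0\<close> equals
      \<open>u * poly p u / exp u\<close> with \<open>u = inverse h\<close>; \<open>pCons 0\<close>
      supplies the extra factor \<open>u\<close>.\<close>
    have R: "((\<lambda>h. flat p h / h) \<longlongrightarrow> 0) (at_right 0)"
    proof (rule Lim_transform_eventually)
      show "((\<lambda>h::real. poly (pCons 0 p) (inverse h) / exp (inverse h)) \<longlongrightarrow> 0) (at_right 0)"
        by (rule filterlim_compose[OF poly_div_exp_tendsto_0 filterlim_inverse_at_top_right])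
      show "\<forall>\<^sub>F h in at_right 0. poly (pCons 0 p) (inverse h) / exp (inverse h) = flat p h / h"
        by (rule eventually_at_right_less[THEN eventually_mono])
           (auto simp: flat_def field_simps exp_minus)
    qed
    have L: "((\<lambda>h. flat p h / h) \<longlongrightarrow> 0) (at_left 0)"
      by (rule Lim_transform_eventually[OF tendsto_const])
         (auto simp: flat_def eventually_at_left_field intro!: exI[of _ "-1"])
    show ?thesis
      using filterlim_split_at_real[OF L R] 3
      by (simp add: DERIV_def flat_def)
  qed
qed

lemma differentiable_upto_flat: "differentiable_upto n (flat p)"
proof (induction n arbitrary: p)
  case 0
  show ?case
    using flat_has_field_derivative by (auto simp: differentiable_upto_0 field_differentiable_def)
next
  case (Suc n)
  have "deriv (flat p) = flat ([:0, 0, 1:] * (p - pderiv p))"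
    using flat_has_field_derivative by (auto intro: DERIV_imp_deriv)
  then show ?case
    using flat_has_field_derivative Suc
    by (auto simp: differentiable_upto_Suc field_differentiable_def)
qed

text \<open>Since \<open>flat 1 t\<close> is \<open>exp (- (1 / t))\<close> for
  \<open>t > 0\<close>, scaling the argument by \<open>N\<close> drives both factors to
  \<open>1\<close> inside the interval, while the support stays fixed. The bumps are thus smooth
  approximations of the indicator, bounded by \<open>1\<close>.\<close>

definition bump :: "real \<Rightarrow> real \<Rightarrow> nat \<Rightarrow> real \<Rightarrow> real" where
  "bump a b N x = flat 1 (real N * (x - a)) * flat 1 (real N * (b - x))"

lemma differentiable_upto_bump: "differentiable_upto n (bump a b N)"
proof -
  have "differentiable_upto n (\<lambda>x. flat 1 (real N * x + (- real N * a)) * flat 1 (- real N * x + real N * b))"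
    by (intro differentiable_upto_mult differentiable_upto_affine differentiable_upto_flat)
  then show ?thesis by (simp add: bump_def[abs_def] algebra_simps)
qed

lemma flat_1_bounds: "0 \<le> flat 1 x" "flat 1 x \<le> 1"
  by (auto simp: flat_def)

lemma bump_bounds: "0 \<le> bump a b N x" "bump a b N x \<le> 1"
  by (auto simp: bump_def flat_1_bounds mult_le_one)

lemma bump_eq_0: "x \<notin> {a<..<b} \<Longrightarrow> bump a b N x = 0"
  by (auto simp: bump_def flat_def zero_less_mult_iff not_less)

lemma flat_1_scale_tendsto:
  assumes "c > 0" shows "(\<lambda>N. flat 1 (real N * c)) \<longlonglongrightarrow> 1"
proof (rule Lim_transform_eventually)
  have "(\<lambda>N. exp (- (inverse c * (1 / real N)))) \<longlonglongrightarrow> exp (- (inverse c * 0))"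
    by (intro tendsto_intros lim_1_over_n)
  then show "(\<lambda>N. exp (- (inverse c * (1 / real N)))) \<longlonglongrightarrow> 1" by simp
  show "\<forall>\<^sub>F N in sequentially. exp (- (inverse c * (1 / real N))) = flat 1 (real N * c)"
    using eventually_gt_at_top[of 0] by eventually_elim (use assms in \<open>auto simp: flat_def field_simps\<close>)
qed

lemma bump_tendsto_indicator: "(\<lambda>N. bump a b N x) \<longlonglongrightarrow> indicator {a<..<b} x"
proof (cases "x \<in> {a<..<b}")
  case True
  then have "(\<lambda>N. bump a b N x) \<longlonglongrightarrow> 1 * 1"
    unfolding bump_def by (intro tendsto_mult flat_1_scale_tendsto) auto
  with True show ?thesis by simp
next
  case False
  then show ?thesis by (simp add: bump_eq_0)
qed

lemma continuous_bump: "isCont (bump a b N) x"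
  using differentiable_upto_bump[of 0 a b N]
  by (auto simp: differentiable_upto_0 intro: field_differentiable_imp_continuous_at)

lemma obtain_bump_primitive:
  assumes "a \<le> b"
  obtains P where "\<And>x. (P has_field_derivative bump a b N x) (at x)"
    "\<And>x. x \<le> a \<Longrightarrow> P x = 0" "\<And>x. x \<ge> b \<Longrightarrow> P x = P b" "\<And>x. P x \<in> {0..b - a}"
proof -
  \<comment> \<open>Taking the whole line as the interval gives an antiderivative with a two-sided
    derivative at every point.\<close>
  have "(-\<infinity>::ereal) < \<infinity>" by simp
  then obtain F where F: "\<And>x. (F has_vector_derivative bump a b N x) (at x)"
    using einterval_antiderivative[of "-\<infinity>" \<infinity> "bump a b N"] continuous_bump by auto
  define P where "P x = F x - F a" for x
  have D: "(P has_field_derivative bump a b N x) (at x)" for x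
    using F[of x] unfolding P_def by (auto intro!: derivative_eq_intros simp: has_real_derivative_iff_has_vector_derivative)
  have mono: "P x \<le> P y" if "x \<le> y" for x y
    using DERIV_nonneg_imp_nondecreasing[OF that, of P] D bump_bounds(1) by blast
  have lip: "P x - P y \<le> x - y" if "y \<le> x" for x y
  proof (cases "y = x")
    case False
    with that have "y < x" by simp
    from MVT2[OF this, of P] D obtain z where "P x - P y = (x - y) * bump a b N z" by blast
    then show ?thesis using mult_left_mono[OF bump_bounds(2), of "x - y" a b N z] that by simp
  qed auto
  have left: "P x = 0" if "x \<le> a" for x
  proof (cases "x = a")
    case False
    with that have "x < a" by simp
    from MVT2[OF this, of P] D obtain z where "z < a" "P a - P x = (a - x) * bump a b N z" by blast
    then show ?thesis by (simp add: P_def bump_eq_0)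
  qed (simp add: P_def)
  have right: "P x = P b" if "x \<ge> b" for x
  proof (cases "x = b")
    case False
    with that have "b < x" by simp
    from MVT2[OF this, of P] D obtain z where "b < z" "P x - P b = (x - b) * bump a b N z" by blast
    then show ?thesis by (simp add: bump_eq_0)
  qed simp
  have "P x \<in> {0..b - a}" for x
  proof -
    have "P x \<ge> 0" using mono[of a x] left[of a] left[of x] by (cases "x \<le> a") auto
    moreover have "P x \<le> P b" using mono[of x b] right[of x] by (cases "x \<le> b") auto
    ultimately show ?thesis using lip[of a b] left[of a] assms by auto
  qed
  with D left right show ?thesis using that by blast
qed

subsection \<open>Continuity of functions with a weak derivative\<close>

text \<open>On a set of finite measure this follows from \<open>t \<le> 1 + t^2\<close>.\<close>

lemma L2_imp_integrable:
  assumes "f \<in> L2 S" "S \<in> lmeasurable"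
  shows "integrable (lebesgue_on S) f"
proof (rule Bochner_Integration.integrable_bound)
  interpret finite_measure "lebesgue_on S"
    using assms(2) by (rule finite_measure_lebesgue_on)
  show "integrable (lebesgue_on S) (\<lambda>x. 1 + (norm (f x))\<^sup>2)"
    using assms(1) by (auto simp: L2_def)
  have "norm (f x) \<le> norm (1 + (norm (f x))\<^sup>2)" for x
    using self_le_power[of "norm (f x)" 2]
    by (cases "norm (f x) \<le> 1") (auto intro: add_increasing2)
  then show "AE x in lebesgue_on S. norm (f x) \<le> norm (1 + (norm (f x))\<^sup>2)" by simp
qed (use assms(1) in \<open>auto simp: L2_def\<close>)

text \<open>This is the bridge between Bochner integrals over \<open>lebesgue_on S\<close>, in which
  weak derivatives are stated, and gauge integrals over subintervals, for which the calculus of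
  indefinite integrals is available.\<close>

lemma lebesgue_on_indicator:
  fixes f :: "'a::euclidean_space \<Rightarrow> 'b::euclidean_space"
  assumes f: "integrable (lebesgue_on S) f" and [measurable]: "S \<in> sets lebesgue" "A \<in> sets lebesgue"
    and "A \<subseteq> S"
  shows "integrable (lebesgue_on S) (\<lambda>x. indicator A x *\<^sub>R f x)"
    and "(\<integral>x. indicator A x *\<^sub>R f x \<partial>lebesgue_on S) = integral A f"
proof -
  have "A \<in> sets (lebesgue_on S)"
    using assms by (simp add: sets_restrict_space_iff)
  then show int: "integrable (lebesgue_on S) (\<lambda>x. indicator A x *\<^sub>R f x)"
    using f by (rule integrable_mult_indicator)
  have "integral S (\<lambda>x. indicator A x *\<^sub>R f x) = integral S (\<lambda>x. if x \<in> A then f x else 0)"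
    by (rule Henstock_Kurzweil_Integration.integral_cong) auto
  also have "\<dots> = integral A f"
    using \<open>A \<subseteq> S\<close> by (simp add: Henstock_Kurzweil_Integration.integral_restrict_Int inf.absorb1)
  finally show "(\<integral>x. indicator A x *\<^sub>R f x \<partial>lebesgue_on S) = integral A f"
    using lebesgue_integral_eq_integral[OF int] by simp
qed

text \<open>
  The test function is the difference of a primitive of a bump on \<open>{x..x + h}\<close> and its translate
  by \<open>y - x\<close>; translating makes both bumps have the same mass, so the difference has compact support.
\<close>
lemma weak_derivative_integral_diff_bound:
  fixes f g :: "real \<Rightarrow> 'a::euclidean_space"
  assumes wd: "weak_derivative {l<..<r} f g"
    and f: "integrable (lebesgue_on {l<..<r}) f" and g: "integrable (lebesgue_on {l<..<r}) g"
    and xy: "l < x" "x \<le> y" "0 < h" "y + h < r"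
  shows "norm (integral {x..x + h} f - integral {y..y + h} f) \<le> h * integral {x..y + h} (\<lambda>t. norm (g t))"
proof -
  let ?M = "lebesgue_on {l<..<r}"
  let ?psi = "\<lambda>N t. bump x (x + h) N t - bump y (y + h) N t"
  have bound: "norm (\<integral>t. ?psi N t *\<^sub>R f t \<partial>?M) \<le> h * integral {x..y + h} (\<lambda>t. norm (g t))" for N
  proof -
    obtain P where P: "\<And>t. (P has_field_derivative bump x (x + h) N t) (at t)"
      "\<And>t. t \<le> x \<Longrightarrow> P t = 0" "\<And>t. t \<ge> x + h \<Longrightarrow> P t = P (x + h)" "\<And>t. P t \<in> {0..x + h - x}"
      using obtain_bump_primitive[of x "x + h" N] xy by auto
    define \<phi> where "\<phi> t = P t - P (t + (x - y))" for t
    have shift: "bump x (x + h) N (t + (x - y)) = bump y (y + h) N t" for t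
      by (simp add: bump_def algebra_simps)
    have "(\<phi> has_field_derivative ?psi N t) (at t)" for t
      unfolding \<phi>_def shift[symmetric]
      by (intro DERIV_diff P(1)) (use P(1)[of "t + (x - y)"] in \<open>simp only: DERIV_shift\<close>)
    then have deriv: "deriv \<phi> = ?psi N"
      by (auto intro: DERIV_imp_deriv)
    \<comment> \<open>Left of \<open>x\<close> both terms vanish; right of \<open>y + h\<close> both
      equal \<open>P (x + h)\<close> and cancel.\<close>
    have supp: "\<phi> t = 0" if "t \<notin> {x..y + h}" for t
      using that P(2)[of t] P(2)[of "t + (x - y)"] P(3)[of t] P(3)[of "t + (x - y)"] xy
      by (cases "t < x") (auto simp: \<phi>_def)
    \<comment> \<open>Both values of \<open>P\<close> lie in \<open>{0..h}\<close>; this is the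
      source of the factor \<open>h\<close> in the bound.\<close>
    have "\<bar>\<phi> t\<bar> \<le> h" for t
      using P(4)[of t] P(4)[of "t + (x - y)"] by (auto simp: \<phi>_def)
    then have le: "\<bar>\<phi> t\<bar> \<le> h * indicator {x..y + h} t" for t
      using supp by (auto simp: indicator_def)
    have "differentiable_upto n P" for n
    proof (cases n)
      case (Suc m)
      have "deriv P = bump x (x + h) N" using P(1) by (auto intro: DERIV_imp_deriv)
      then show ?thesis
        using Suc P(1) by (auto simp: differentiable_upto_Suc differentiable_upto_bump field_differentiable_def)
    qed (use P(1) in \<open>auto simp: differentiable_upto_0 field_differentiable_def\<close>)
    then have "differentiable_upto n (\<lambda>t. P t + (-1) * P (1 * t + (x - y)))" for n
      by (intro differentiable_upto_add differentiable_upto_mult differentiable_upto_const differentiable_upto_affine)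
    then have "differentiable_upto n \<phi>" for n
      by (simp add: \<phi>_def[abs_def])
    then have test: "test_function {l<..<r} \<phi>"
      unfolding test_function_def differentiable_upto_def
      using supp xy by (auto intro!: exI[of _ "{x..y + h}"])
    have "(\<integral>t. ?psi N t *\<^sub>R f t \<partial>?M) = - (\<integral>t. \<phi> t *\<^sub>R g t \<partial>?M)"
      using wd[unfolded weak_derivative_def, rule_format, OF test] by (simp only: deriv)
    then have "norm (\<integral>t. ?psi N t *\<^sub>R f t \<partial>?M) \<le> (\<integral>t. norm (\<phi> t *\<^sub>R g t) \<partial>?M)"
      using integral_norm_bound[of ?M "\<lambda>t. \<phi> t *\<^sub>R g t"] by simp
    also have "\<dots> \<le> (\<integral>t. h * (indicator {x..y + h} t *\<^sub>R norm (g t)) \<partial>?M)"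
    proof (rule integral_mono')
      show "integrable ?M (\<lambda>t. h * (indicator {x..y + h} t *\<^sub>R norm (g t)))"
        using xy by (intro integrable_mult_right lebesgue_on_indicator integrable_norm g) auto
      show "norm (\<phi> t *\<^sub>R g t) \<le> h * (indicator {x..y + h} t *\<^sub>R norm (g t))" for t
        using mult_right_mono[OF le[of t], of "norm (g t)"] by (simp add: mult.assoc)
      show "0 \<le> h * (indicator {x..y + h} t *\<^sub>R norm (g t))" for t
        using xy by simp
    qed
    also have "\<dots> = h * integral {x..y + h} (\<lambda>t. norm (g t))"
      using xy lebesgue_on_indicator(2)[OF integrable_norm[OF g], of "{x..y + h}"]
      by (simp add: subset_iff)
    finally show ?thesis .
  qed
  \<comment> \<open>The bound is uniform in \<open>N\<close>. Letting \<open>N\<close> grow turns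
    the bumps into indicators, by dominated convergence with majorant
    \<open>norm (f t)\<close>.\<close>
  have "(\<lambda>N. \<integral>t. ?psi N t *\<^sub>R f t \<partial>?M) \<longlonglongrightarrow>
      (\<integral>t. indicator {x<..<x + h} t *\<^sub>R f t - indicator {y<..<y + h} t *\<^sub>R f t \<partial>?M)"
  proof (rule integral_dominated_convergence)
    show "integrable ?M (\<lambda>t. norm (f t))" using f by simp
    have [measurable]: "f \<in> borel_measurable ?M" using f by simp
    have [measurable]: "bump a b N \<in> borel_measurable ?M" for a b N
      by (rule continuous_imp_measurable_on_sets_lebesgue)
         (auto intro: continuous_at_imp_continuous_on continuous_bump)
    show "(\<lambda>t. ?psi N t *\<^sub>R f t) \<in> borel_measurable ?M" for N
      by measurable
    have "\<bar>?psi N t\<bar> \<le> 1" for N t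
      using bump_bounds[of x "x + h" N t] bump_bounds[of y "y + h" N t] by linarith
    then show "AE t in ?M. norm (?psi N t *\<^sub>R f t) \<le> norm (f t)" for N
      by (auto intro!: AE_I2 mult_left_le_one_le)
    show "AE t in ?M. (\<lambda>N. ?psi N t *\<^sub>R f t) \<longlonglongrightarrow>
        indicator {x<..<x + h} t *\<^sub>R f t - indicator {y<..<y + h} t *\<^sub>R f t"
      by (auto intro!: AE_I2 tendsto_intros bump_tendsto_indicator simp: scaleR_diff_left)
    show "(\<lambda>t. indicator {x<..<x + h} t *\<^sub>R f t - indicator {y<..<y + h} t *\<^sub>R f t) \<in> borel_measurable ?M"
      by (intro borel_measurable_diff borel_measurable_integrable lebesgue_on_indicator f) (use xy in auto)
  qed
  also have "(\<integral>t. indicator {x<..<x + h} t *\<^sub>R f t - indicator {y<..<y + h} t *\<^sub>R f t \<partial>?M) =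
      integral {x..x + h} f - integral {y..y + h} f"
  proof -
    have "{x<..<x + h} \<subseteq> {l<..<r}" "{y<..<y + h} \<subseteq> {l<..<r}"
      using xy by auto
    with f show ?thesis
      by (simp add: lebesgue_on_indicator integral_open_interval_real)
  qed
  finally show ?thesis
    by (intro LIMSEQ_le_const2[OF tendsto_norm]) (auto intro: bound)
qed

text \<open>This is Lebesgue differentiation with averages taken to the right of the point.\<close>

lemma integral_average_tendsto:
  fixes f :: "real \<Rightarrow> 'a::euclidean_space"
  assumes "\<And>a b. f integrable_on {a..b}"
  obtains N where "negligible N"
    "\<And>x. x \<notin> N \<Longrightarrow> ((\<lambda>h. integral {x..x + h} f /\<^sub>R h) \<longlongrightarrow> f x) (at_right 0)"
proof -
  obtain N where N: "negligible N"
    "\<And>x e. x \<notin> N \<Longrightarrow> 0 < e \<Longrightarrow>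
       \<exists>d>0. \<forall>h. 0 < h \<and> h < d \<longrightarrow> norm (integral (cbox x (x + h *\<^sub>R One)) f /\<^sub>R h ^ DIM(real) - f x) < e"
    using integrable_ccontinuous_explicit[of f] assms by (metis cbox_interval)
  have "((\<lambda>h. integral {x..x + h} f /\<^sub>R h) \<longlongrightarrow> f x) (at_right 0)" if "x \<notin> N" for x
    unfolding tendsto_iff
  proof (intro allI impI)
    fix e :: real assume "e > 0"
    with N(2)[OF that, of e] obtain d where "d > 0"
      "\<And>h. 0 < h \<Longrightarrow> h < d \<Longrightarrow> norm (integral {x..x + h} f /\<^sub>R h - f x) < e"
      by auto
    then show "\<forall>\<^sub>F h in at_right 0. dist (integral {x..x + h} f /\<^sub>R h) (f x) < e"
      by (auto simp: eventually_at_right_field dist_norm)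
  qed
  with N(1) that show ?thesis by blast
qed

text \<open>Divide the bound on the two integrals of \<open>f\<close> by \<open>h\<close> and let
  \<open>h\<close> tend to \<open>0\<close>: at Lebesgue points the averages tend to
  \<open>f x\<close> and \<open>f y\<close>.\<close>

lemma weak_derivative_diff_bound:
  fixes f g :: "real \<Rightarrow> 'a::euclidean_space"
  assumes wd: "weak_derivative {l<..<r} f g"
    and f: "integrable (lebesgue_on {l<..<r}) f" and g: "integrable (lebesgue_on {l<..<r}) g"
  obtains N where "negligible N"
    "\<And>x y. x \<in> {l<..<r} - N \<Longrightarrow> y \<in> {l<..<r} - N \<Longrightarrow> x \<le> y \<Longrightarrow>
       norm (f x - f y) \<le> integral {x..y} (\<lambda>t. norm (g t))"
proof -
  \<comment> \<open>Outside the interval \<open>f\<close> is arbitrary. Extension by zero makes it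
    integrable on every compact interval, as the differentiation lemma requires.\<close>
  define F where "F t = (if t \<in> {l<..<r} then f t else 0)" for t
  have "F integrable_on UNIV"
    using integrable_on_lebesgue_on[OF f] unfolding F_def
    by (simp only: Henstock_Kurzweil_Integration.integrable_restrict_UNIV) simp
  then have "F integrable_on {a..b}" for a b
    by (rule integrable_on_subinterval) simp
  then obtain N where N: "negligible N"
    "\<And>x. x \<notin> N \<Longrightarrow> ((\<lambda>h. integral {x..x + h} F /\<^sub>R h) \<longlongrightarrow> F x) (at_right 0)"
    by (rule integral_average_tendsto) blast
  have "norm (f x - f y) \<le> integral {x..y} (\<lambda>t. norm (g t))"
    if xy: "x \<in> {l<..<r} - N" "y \<in> {l<..<r} - N" "x \<le> y" for x y
  proof -
    \<comment> \<open>Any point strictly between \<open>y\<close> and \<open>r\<close> serves: it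
      leaves room for the upper limit \<open>y + h\<close> to approach \<open>y\<close> from the
      right.\<close>
    define s where "s = (y + r) / 2"
    have s: "y < s" "s < r" using xy by (auto simp: s_def)
    have G: "(\<lambda>t. norm (g t)) integrable_on {x..s}"
      by (rule integrable_on_subinterval[OF integrable_on_lebesgue_on[OF integrable_norm[OF g]]])
         (use xy s in auto)
    have "continuous_on {x..s} (\<lambda>u. integral {x..u} (\<lambda>t. norm (g t)))"
      by (rule indefinite_integral_continuous_1[OF G])
    then have "((\<lambda>u. integral {x..u} (\<lambda>t. norm (g t))) \<longlongrightarrow> integral {x..y} (\<lambda>t. norm (g t))) (at y within {x..s})"
      using xy s by (auto simp: continuous_on)
    then have "((\<lambda>u. integral {x..u} (\<lambda>t. norm (g t))) \<longlongrightarrow> integral {x..y} (\<lambda>t. norm (g t))) (at y within {y..s})"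
      by (rule tendsto_within_subset) (use xy in auto)
    then have "((\<lambda>u. integral {x..u} (\<lambda>t. norm (g t))) \<longlongrightarrow> integral {x..y} (\<lambda>t. norm (g t))) (at_right y)"
      using s by (simp add: at_within_Icc_at_right)
    then have lim: "((\<lambda>h. integral {x..y + h} (\<lambda>t. norm (g t))) \<longlongrightarrow> integral {x..y} (\<lambda>t. norm (g t))) (at_right 0)"
      by (simp add: filterlim_at_right_to_0[of _ _ y] add.commute)
    have ev: "\<forall>\<^sub>F h in at_right 0. norm (integral {x..x + h} F /\<^sub>R h - integral {y..y + h} F /\<^sub>R h) \<le>
        integral {x..y + h} (\<lambda>t. norm (g t))"
    proof -
      have "norm (integral {x..x + h} F /\<^sub>R h - integral {y..y + h} F /\<^sub>R h) \<le>
          integral {x..y + h} (\<lambda>t. norm (g t))" if h: "0 < h" "h < r - y" for h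
      proof -
        have "integral {u..u + h} F = integral {u..u + h} f" if "u \<in> {x, y}" for u
          by (rule Henstock_Kurzweil_Integration.integral_cong) (use that xy h in \<open>auto simp: F_def\<close>)
        then have "norm (integral {x..x + h} F - integral {y..y + h} F) \<le> h * integral {x..y + h} (\<lambda>t. norm (g t))"
          using weak_derivative_integral_diff_bound[OF wd f g, of x y h] xy h by simp
        moreover have "norm (integral {x..x + h} F /\<^sub>R h - integral {y..y + h} F /\<^sub>R h) =
            norm (integral {x..x + h} F - integral {y..y + h} F) / h"
          using h by (simp flip: scaleR_diff_right add: divide_inverse mult.commute)
        moreover have "norm (integral {x..x + h} F - integral {y..y + h} F) / h \<le> integral {x..y + h} (\<lambda>t. norm (g t))"
          using h calculation(1) by (simp add: pos_divide_le_eq mult.commute)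
        ultimately show ?thesis
          by simp
      qed
      then show ?thesis
        using xy by (auto simp: eventually_at_right_field intro!: exI[of _ "r - y"])
    qed
    have "norm (F x - F y) \<le> integral {x..y} (\<lambda>t. norm (g t))"
      by (rule tendsto_le[OF _ lim tendsto_norm[OF tendsto_diff] ev]) (use N(2) xy in auto)
    with xy show ?thesis by (simp add: F_def)
  qed
  with N(1) that show ?thesis by blast
qed

text \<open>On a set of full measure \<open>f\<close> agrees with a continuous function. Its values
  stay in the finite set \<open>C\<close>, and a connected finite set has at most one point.\<close>

lemma H1_finite_range_imp_constant:
  fixes f :: "real \<Rightarrow> 'a::euclidean_space"
  assumes f: "f \<in> H1 {l<..<r}" and "finite C" and C: "AE x in lebesgue_on {l<..<r}. f x \<in> C"
  shows "ae_constant_on {l<..<r} f"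
proof -
  let ?S = "{l<..<r}"
  have S: "?S \<in> lmeasurable" by simp
  obtain g where fL: "f \<in> L2 ?S" and gL: "g \<in> L2 ?S" and wd: "weak_derivative ?S f g"
    using f by (auto simp: H1_def)
  note fi = L2_imp_integrable[OF fL S] and gi = L2_imp_integrable[OF gL S]
  obtain N where N: "negligible N"
    "\<And>x y. x \<in> ?S - N \<Longrightarrow> y \<in> ?S - N \<Longrightarrow> x \<le> y \<Longrightarrow>
       norm (f x - f y) \<le> integral {x..y} (\<lambda>t. norm (g t))"
    using weak_derivative_diff_bound[OF wd fi gi] by blast
  define X where "X = {x \<in> ?S. x \<notin> N \<and> f x \<in> C}"
  have "AE x in lebesgue. x \<notin> N"
    using N(1) by (simp add: negligible_iff_null_sets AE_not_in)
  moreover have "AE x in lebesgue. x \<in> ?S \<longrightarrow> f x \<in> C"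
    using C by (simp add: AE_restrict_space_iff)
  ultimately have AX: "AE x\<in>?S in lebesgue. x \<in> X"
    by eventually_elim (auto simp: X_def)
  \<comment> \<open>Increments of \<open>\<Gamma>\<close> dominate those of \<open>f\<close> on
    \<open>X\<close>, so \<open>f\<close> inherits uniform continuity there from
    \<open>\<Gamma>\<close>.\<close>
  define \<Gamma> where "\<Gamma> u = integral {l..u} (\<lambda>t. norm (g t))" for u
  have gI: "(\<lambda>t. norm (g t)) integrable_on {l..r}"
    using integrable_on_lebesgue_on[OF integrable_norm[OF gi]]
    by (simp add: integrable_on_open_interval_real)
  have uc: "uniformly_continuous_on {l..r} \<Gamma>"
    unfolding \<Gamma>_def by (intro compact_uniformly_continuous indefinite_integral_continuous_1 gI) simp
  have diff: "norm (f x - f y) \<le> \<bar>\<Gamma> x - \<Gamma> y\<bar>" if "x \<in> X" "y \<in> X" for x y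
  proof -
    have *: "norm (f x - f y) \<le> \<Gamma> y - \<Gamma> x" if "x \<in> X" "y \<in> X" "x \<le> y" for x y
    proof -
      have "(\<lambda>t. norm (g t)) integrable_on {l..y}"
        by (rule integrable_on_subinterval[OF gI]) (use that in \<open>auto simp: X_def\<close>)
      then have "\<Gamma> x + integral {x..y} (\<lambda>t. norm (g t)) = \<Gamma> y"
        unfolding \<Gamma>_def using that
        by (intro Henstock_Kurzweil_Integration.integral_combine) (auto simp: X_def)
      with N(2)[of x y] that show ?thesis by (auto simp: X_def)
    qed
    show ?thesis using *[of x y] *[of y x] that by (cases "x \<le> y") (auto simp: norm_minus_commute)
  qed
  have "uniformly_continuous_on X f"
    unfolding uniformly_continuous_on_def dist_norm
  proof (intro allI impI)
    fix e :: real
    assume "e > 0"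
    with uc obtain d where d: "d > 0"
      "\<And>x x'. x \<in> {l..r} \<Longrightarrow> x' \<in> {l..r} \<Longrightarrow> \<bar>x' - x\<bar> < d \<Longrightarrow> \<bar>\<Gamma> x' - \<Gamma> x\<bar> < e"
      unfolding uniformly_continuous_on_def dist_norm real_norm_def by blast
    have "norm (f x' - f x) < e" if "x \<in> X" "x' \<in> X" "\<bar>x' - x\<bar> < d" for x x'
      using diff[of x' x] d(2)[of x x'] that by (auto simp: X_def)
    with d(1) show "\<exists>d>0. \<forall>x\<in>X. \<forall>x'\<in>X. norm (x' - x) < d \<longrightarrow> norm (f x' - f x) < e" by (metis real_norm_def)
  qed
  then obtain F where F: "uniformly_continuous_on (closure X) F" "\<And>x. x \<in> X \<Longrightarrow> f x = F x"
    by (rule uniformly_continuous_on_extension_on_closure) blast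
  \<comment> \<open>A closed set containing almost every point of an open set contains all of it, so
    \<open>X\<close> is dense in \<open>?S\<close>.\<close>
  have SX: "?S \<subseteq> closure X"
  proof
    fix x assume "x \<in> ?S"
    then show "x \<in> closure X"
      by (rule mem_closed_if_AE_lebesgue_open[rotated -1])
         (use AX closure_subset in \<open>auto elim!: eventually_mono\<close>)
  qed
  have cont: "continuous_on (closure X) F"
    using F(1) by (rule uniformly_continuous_imp_continuous)
  have "F ` closure X \<subseteq> C"
    by (rule image_closure_subset[OF cont finite_imp_closed[OF \<open>finite C\<close>]])
       (use F(2) in \<open>auto simp: X_def\<close>)
  with SX have "finite (F ` ?S)"
    using \<open>finite C\<close> by (meson finite_subset image_mono order_trans)
  moreover have "connected (F ` ?S)"
    by (intro connected_continuous_image continuous_on_subset[OF cont SX]) simp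
  \<comment> \<open>The empty alternative covers a degenerate interval with
    \<open>r \<le> l\<close>.\<close>
  ultimately have "F ` ?S = {} \<or> (\<exists>c. F ` ?S = {c})"
    by (simp only: connected_finite_iff_sing)
  then obtain c where c: "\<And>x. x \<in> ?S \<Longrightarrow> F x = c"
    by blast
  have "AE x in lebesgue. x \<in> ?S \<longrightarrow> f x = c"
    using AX by eventually_elim (use F(2) c in auto)
  then show ?thesis
    by (auto simp: ae_constant_on_def AE_restrict_space_iff)
qed

subsection \<open>Limits in \<open>L2\<close> and cosine series\<close>

text \<open>The integral of the square of \<open>d\<close> is below the squared \<open>L2\<close>
  error for every \<open>n \<ge> n0\<close>, hence is \<open>0\<close>. This turns \<open>L2\<close>
  convergence into almost-everywhere statements without passing to subsequences.\<close>

lemma tendsto_L2_AE_eq_0: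
  assumes lim: "tendsto_L2 S F f" and d: "d \<in> borel_measurable (lebesgue_on S)"
    and le: "\<And>n x. n \<ge> n0 \<Longrightarrow> \<bar>d x\<bar> \<le> norm (F n x - f x)"
  shows "AE x in lebesgue_on S. d x = (0::real)"
proof -
  let ?M = "lebesgue_on S"
  have [measurable]: "F n \<in> borel_measurable ?M" "f \<in> borel_measurable ?M" "d \<in> borel_measurable ?M" for n
    using lim d by (auto simp: tendsto_L2_def L2_def)
  \<comment> \<open>Monotonicity of the integral needs this, because a non-integrable function has
    Bochner integral \<open>0\<close>.\<close>
  have int: "integrable ?M (\<lambda>x. (norm (F n x - f x))\<^sup>2)" for n
  proof (rule Bochner_Integration.integrable_bound)
    show "integrable ?M (\<lambda>x. 2 * (norm (F n x))\<^sup>2 + 2 * (norm (f x))\<^sup>2)"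
      using lim by (auto simp: tendsto_L2_def L2_def)
    have "(norm (F n x - f x))\<^sup>2 \<le> 2 * (norm (F n x))\<^sup>2 + 2 * (norm (f x))\<^sup>2" for x
    proof -
      have "(norm (F n x - f x))\<^sup>2 \<le> (norm (F n x) + norm (f x))\<^sup>2"
        by (intro power_mono norm_triangle_ineq4) simp
      also have "\<dots> \<le> 2 * (norm (F n x))\<^sup>2 + 2 * (norm (f x))\<^sup>2"
        using zero_le_power2[of "norm (F n x) - norm (f x)"] by (simp add: power2_sum power2_diff)
      finally show ?thesis .
    qed
    then show "AE x in ?M. norm ((norm (F n x - f x))\<^sup>2) \<le> norm (2 * (norm (F n x))\<^sup>2 + 2 * (norm (f x))\<^sup>2)"
      by (auto intro!: AE_I2)
  qed measurable
  have sq: "(d x)\<^sup>2 \<le> (norm (F n x - f x))\<^sup>2" if "n \<ge> n0" for n x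
    using le[OF that, of x] by (simp add: abs_le_square_iff[symmetric])
  have dint: "integrable ?M (\<lambda>x. (d x)\<^sup>2)"
    by (rule Bochner_Integration.integrable_bound[OF int[of n0]]) (use sq in auto)
  have "(\<lambda>n. (L2_norm S (\<lambda>x. F n x - f x))\<^sup>2) \<longlonglongrightarrow> 0\<^sup>2"
    using lim by (intro tendsto_power) (simp add: tendsto_L2_def)
  then have "(\<integral>x. (d x)\<^sup>2 \<partial>?M) \<le> 0\<^sup>2"
  proof (rule LIMSEQ_le_const, intro exI allI impI)
    fix n assume "n0 \<le> n"
    then have "(\<integral>x. (d x)\<^sup>2 \<partial>?M) \<le> (\<integral>x. (norm (F n x - f x))\<^sup>2 \<partial>?M)"
      by (intro integral_mono dint int sq)
    then show "(\<integral>x. (d x)\<^sup>2 \<partial>?M) \<le> (L2_norm S (\<lambda>x. F n x - f x))\<^sup>2"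
      by (simp add: L2_norm_def)
  qed
  then have "(\<integral>x. (d x)\<^sup>2 \<partial>?M) = 0"
    by (intro antisym) simp_all
  then show ?thesis
    using dint by (simp add: integral_nonneg_eq_0_iff_AE)
qed

text \<open>Since every \<open>F n x\<close> lies in \<open>C\<close>, the distance from
  \<open>f x\<close> to \<open>C\<close> is at most each error. It therefore vanishes almost
  everywhere, and closedness gives membership.\<close>

lemma tendsto_L2_AE_mem_closed:
  assumes lim: "tendsto_L2 S F f" and "closed C" and FC: "\<And>n x. F n x \<in> C"
  shows "AE x in lebesgue_on S. f x \<in> C"
proof -
  have C: "C \<noteq> {}" using FC by blast
  have "AE x in lebesgue_on S. infdist (f x) C = 0"
  proof (rule tendsto_L2_AE_eq_0[OF lim])
    have "f \<in> borel_measurable (lebesgue_on S)"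
      using lim by (simp add: tendsto_L2_def L2_def)
    then show "(\<lambda>x. infdist (f x) C) \<in> borel_measurable (lebesgue_on S)"
      by (rule measurable_compose) (intro borel_measurable_continuous_onI continuous_intros)
    show "\<bar>infdist (f x) C\<bar> \<le> norm (F n x - f x)" for n x
      using infdist_le[OF FC, of "f x" n x] by (simp add: infdist_nonneg dist_norm norm_minus_commute)
  qed
  then show ?thesis
    by eventually_elim (use C \<open>closed C\<close> in \<open>simp add: in_closed_iff_infdist_zero\<close>)
qed

lemma finite_sphere_Int_subspace:
  fixes V :: "'a::euclidean_space set"
  assumes "subspace V" "dim V < 2"
  shows "finite (V \<inter> sphere 0 r)"
proof -
  obtain B where B: "B \<subseteq> V" "independent B" "V \<subseteq> span B" "card B = dim V"
    using basis_exists by blast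
  have fin: "finite B" using B(2) by (rule independent_imp_finite)
  have "\<exists>b. V \<subseteq> span {b}"
  proof (cases "B = {}")
    case False
    with B(4) assms(2) fin have "card B = 1"
      by (metis One_nat_def Suc_1 card_0_eq less_2_cases)
    with B(3) show ?thesis by (auto simp: card_1_singleton_iff)
  qed (use B(3) span_mono in blast)
  then obtain b where b: "V \<subseteq> span {b}" by blast
  \<comment> \<open>The listed \<open>0\<close> accounts for \<open>b = 0\<close>; otherwise the
    sign of the coefficient decides between the other two points.\<close>
  have "V \<inter> sphere 0 r \<subseteq> {0, (r / norm b) *\<^sub>R b, (- r / norm b) *\<^sub>R b}"
  proof
    fix x assume x: "x \<in> V \<inter> sphere 0 r"
    with b obtain c where c: "x = c *\<^sub>R b" by (auto simp: span_singleton)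
    then have "\<bar>c\<bar> * norm b = r" using x by simp
    then show "x \<in> {0, (r / norm b) *\<^sub>R b, (- r / norm b) *\<^sub>R b}"
      using c by (cases "b = 0"; cases "c \<ge> 0") auto
  qed
  then show ?thesis by (rule finite_subset) simp
qed

section \<open>Trigonometric polynomials with values in the sphere\<close>

fun chebyshev_poly :: "nat \<Rightarrow> real poly" where
  "chebyshev_poly 0 = 1"
| "chebyshev_poly (Suc 0) = [:0, 1:]"
| "chebyshev_poly (Suc (Suc n)) = [:0, 2:] * chebyshev_poly (Suc n) - chebyshev_poly n"

lemma poly_chebyshev_cos: "poly (chebyshev_poly n) (cos t) = cos (real n * t)"
proof (induction n rule: chebyshev_poly.induct)
  case (3 n)
  have "cos (real (Suc (Suc n)) * t) + cos (real n * t) = 2 * cos t * cos (real (Suc n) * t)"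
    using cos_add[of "real (Suc n) * t" t] cos_diff[of "real (Suc n) * t" t]
    by (simp add: algebra_simps)
  with 3 show ?case by simp
qed auto

text \<open>A real polynomial of positive degree is unbounded as its argument tends to
  infinity.\<close>

lemma bounded_real_poly_constant:
  fixes p :: "real poly"
  assumes "\<And>x. \<bar>poly p x\<bar> \<le> B"
  shows "degree p = 0"
proof (rule ccontr)
  assume "degree p \<noteq> 0"
  then have "filterlim (poly p) at_infinity at_top"
    using filterlim_poly_at_infinity[of p] filterlim_mono[OF _ order_refl at_top_le_at_infinity] by auto
  then have "\<forall>\<^sub>F x in at_top. B + 1 \<le> norm (poly p x)"
    by (auto simp: filterlim_at_infinity[of "\<bar>B\<bar>"] filterlim_at_infinity_conv_norm_at_top filterlim_at_top)
  then obtain x where "B + 1 \<le> norm (poly p x)"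
    by (auto simp: eventually_at_top_linorder)
  with assms[of x] show False by simp
qed

lemma trig_poly_on_sphere_constant:
  fixes a :: "nat \<Rightarrow> 'a::euclidean_space"
  assumes norm: "\<And>x. x \<in> {0<..<1} \<Longrightarrow> norm (\<Sum>k\<le>n. cos (2 * pi * real k * x) *\<^sub>R a k) = 1"
  obtains c where "\<And>x. (\<Sum>k\<le>n. cos (2 * pi * real k * x) *\<^sub>R a k) = c"
proof -
  define P where "P b = (\<Sum>k\<le>n. smult (a k \<bullet> b) (chebyshev_poly k))" for b
  have P: "(\<Sum>k\<le>n. cos (2 * pi * real k * x) *\<^sub>R a k) \<bullet> b = poly (P b) (cos (2 * pi * x))" for b x
    unfolding P_def
    by (simp add: inner_sum_left poly_sum poly_chebyshev_cos mult_ac)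
  \<comment> \<open>The sphere condition says that \<open>Q\<close> vanishes at every value
    \<open>cos (2 * pi * x)\<close>. Infinitely many roots force \<open>Q = 0\<close>, which extends
    the identity from \<open>{-1<..<1}\<close> to all reals, where boundedness forces
    constancy.\<close>
  define Q where "Q = (\<Sum>b\<in>Basis. (P b)\<^sup>2) - 1"
  have "poly Q t = 0" if "t \<in> {-1<..<1}" for t
  proof -
    \<comment> \<open>This preimage of \<open>t\<close> under \<open>cos (2 * pi * x)\<close> lies
      in the first half of the unit interval.\<close>
    define x where "x = arccos t / (2 * pi)"
    have "0 < arccos t" "arccos t < pi"
      using that arccos_lt_bounded[of t] by auto
    then have x: "x \<in> {0<..<1}"
      by (auto simp: x_def field_simps)
    have t: "cos (2 * pi * x) = t"
      using that by (simp add: x_def)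
    have "(norm (\<Sum>k\<le>n. cos (2 * pi * real k * x) *\<^sub>R a k))\<^sup>2 = 1"
      using norm[OF x] by simp
    then have "(\<Sum>b\<in>Basis. (poly (P b) t)\<^sup>2) = 1"
      by (subst (asm) power2_norm_eq_inner, subst (asm) euclidean_inner)
         (simp only: P t power2_eq_square)
    then show ?thesis
      by (simp add: Q_def poly_sum)
  qed
  then have "{-1<..<1} \<subseteq> {t. poly Q t = 0}" by blast
  moreover have "infinite {-1<..<1::real}" by (simp add: infinite_Ioo)
  ultimately have "Q = 0"
    using poly_roots_finite finite_subset by blast
  have sum1: "(\<Sum>b\<in>Basis. (poly (P b) t)\<^sup>2) = 1" for t
  proof -
    have "poly Q t = 0" using \<open>Q = 0\<close> by simp
    then show ?thesis by (simp add: Q_def poly_sum)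
  qed
  have "\<bar>poly (P b) t\<bar> \<le> 1" if "b \<in> Basis" for b t
    using member_le_sum[OF that, of "\<lambda>b. (poly (P b) t)\<^sup>2"] sum1[of t]
    by (simp add: abs_square_le_1)
  then have deg: "degree (P b) = 0" if "b \<in> Basis" for b
    using that bounded_real_poly_constant by blast
  have const: "poly (P b) t = poly (P b) 0" if "b \<in> Basis" for b t
  proof -
    obtain c where "P b = [:c:]"
      using deg[OF \<open>b \<in> Basis\<close>] by (rule degree_eq_zeroE)
    then show ?thesis by simp
  qed
  have "(\<Sum>k\<le>n. cos (2 * pi * real k * x) *\<^sub>R a k) = (\<Sum>b\<in>Basis. poly (P b) 0 *\<^sub>R b)" for x
    by (subst euclidean_representation[symmetric]) (rule sum.cong[OF refl], subst P, subst const, auto)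
  with that show ?thesis by blast
qed

text \<open>The partial sums are stationary from index \<open>n\<close> on, so \<open>f\<close>
  equals the trigonometric polynomial \<open>p\<close> almost everywhere.\<close>

lemma finite_cosine_series_on_sphere_constant:
  fixes f :: "real \<Rightarrow> 'a::euclidean_space"
  assumes sphere: "AE x in lebesgue_on {0<..<1}. f x \<in> sphere 0 1"
    and series: "has_cosine_series f a" and fin: "\<And>k. k > n \<Longrightarrow> a k = 0"
  shows "ae_constant_on {0<..<1} f"
proof -
  define p where "p x = (\<Sum>k\<le>n. cos (2 * pi * real k * x) *\<^sub>R a k)" for x
  have lim: "tendsto_L2 {0<..<1} (\<lambda>n x. \<Sum>k\<le>n. cos (2 * pi * real k * x) *\<^sub>R a k) f"
    using series by (simp add: has_cosine_series_def)
  have tail: "(\<Sum>k\<le>m. cos (2 * pi * real k * x) *\<^sub>R a k) = p x" if "m \<ge> n" for m x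
    unfolding p_def using that fin by (intro sum.mono_neutral_right) auto
  have cont: "continuous_on S p" for S
    unfolding p_def by (intro continuous_intros)
  have "AE x in lebesgue_on {0<..<1}. norm (p x - f x) = 0"
  proof (rule tendsto_L2_AE_eq_0[OF lim, where ?n0.0 = n])
    have "p \<in> borel_measurable (lebesgue_on {0<..<1})"
      by (intro continuous_imp_measurable_on_sets_lebesgue cont) simp
    moreover have "f \<in> borel_measurable (lebesgue_on {0<..<1})"
      using lim by (simp add: tendsto_L2_def L2_def)
    ultimately show "(\<lambda>x. norm (p x - f x)) \<in> borel_measurable (lebesgue_on {0<..<1})"
      by measurable
  qed (use tail in auto)
  then have eq: "AE x in lebesgue_on {0<..<1}. f x = p x"
    by eventually_elim simp
  then have "AE x in lebesgue_on {0<..<1}. norm (p x) = 1"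
    using sphere by eventually_elim simp
  \<comment> \<open>The norm condition on \<open>p\<close> is closed by continuity, so it passes
    from almost every point to every point of the open interval.\<close>
  then have "AE x\<in>{0<..<1} in lebesgue. x \<in> {x. norm (p x) = 1}"
    by (simp add: AE_restrict_space_iff)
  moreover have "closed {x. norm (p x) = 1}"
    by (intro closed_Collect_eq continuous_intros cont)
  ultimately have "norm (p x) = 1" if "x \<in> {0<..<1}" for x
    using mem_closed_if_AE_lebesgue_open[OF open_greaterThanLessThan _ _ that] by blast
  then obtain c where "\<And>x. p x = c"
    using trig_poly_on_sphere_constant[where n = n and a = a] unfolding p_def by blast
  with eq show ?thesis
    by (auto simp: ae_constant_on_def)
qed

theorem lemmaF2:
  fixes f :: "real \<Rightarrow> real ^ 3" and a :: "nat \<Rightarrow> real ^ 3"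
  assumes sphere: "AE x in lebesgue_on {0<..<1}. f x \<in> sphere 0 1"
    and H1: "f \<in> H1 {0<..<1}"
    and series: "has_cosine_series f a"
  shows "(\<not> ae_constant_on {0<..<1} f \<longrightarrow> dim (span (range a)) \<ge> 2) \<and>
         ((\<exists>n. \<forall>k>n. a k = 0) \<longrightarrow> ae_constant_on {0<..<1} f) \<and>
         (\<not> ae_constant_on {0<..<1} f \<longrightarrow> infinite {k. k \<ge> 1 \<and> a k \<noteq> 0})"
proof -
  have finite_modes: "ae_constant_on {0<..<1} f" if "\<And>k. k > n \<Longrightarrow> a k = 0" for n
    using finite_cosine_series_on_sphere_constant[OF sphere series] that by blast
  have "ae_constant_on {0<..<1} f" if "dim (span (range a)) < 2"
  proof -
    let ?V = "span (range a)"
    \<comment> \<open>All partial sums lie in \<open>?V\<close>, and a subspace of a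
      finite-dimensional space is closed.\<close>
    have "AE x in lebesgue_on {0<..<1}. f x \<in> ?V"
      using series unfolding has_cosine_series_def
      by (rule tendsto_L2_AE_mem_closed) (auto intro!: closed_span span_sum span_scale intro: span_base)
    then have "AE x in lebesgue_on {0<..<1}. f x \<in> ?V \<inter> sphere 0 1"
      using sphere by eventually_elim blast
    then show ?thesis
      using H1_finite_range_imp_constant[OF H1 finite_sphere_Int_subspace[OF subspace_span that]] by blast
  qed
  moreover have "ae_constant_on {0<..<1} f" if fin: "finite {k. k \<ge> 1 \<and> a k \<noteq> 0}"
  proof -
    obtain n where n: "\<forall>k\<in>{k. k \<ge> 1 \<and> a k \<noteq> 0}. k \<le> n"
      using fin unfolding finite_nat_set_iff_bounded_le by blast
    \<comment> \<open>The set omits \<open>k = 0\<close>, which is harmless since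
      \<open>k > n\<close> already gives \<open>k \<ge> 1\<close>.\<close>
    have "a k = 0" if "k > n" for k
    proof (rule ccontr)
      assume "a k \<noteq> 0"
      with that have "k \<in> {k. k \<ge> 1 \<and> a k \<noteq> 0}" by simp
      with n have "k \<le> n" by blast
      with that show False by simp
    qed
    then show ?thesis by (rule finite_modes)
  qed
  ultimately show ?thesis
    using finite_modes by (meson not_less)
qed

end
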